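(* Let $d\in\{1,\ldots,m\}$ and $x\in\mathcal H$. Then $P_{\Omega_d}(x)$ is the set of all $M_d^{-1}(y)$, where $y\in\mathcal H$ is characterized, for each index $\xi$, as follows: (i) if $\mathcal G_d(x)[\xi]\neq0$, then $y[\xi]=\dfrac{\sqrt{r_d[\xi]}}{\mathcal G_d(x)[\xi]}\,M_d(x)[\xi]$; (ii) if $\mathcal G_d(x)[\xi]=0$, then $y[\xi]$ varies over (is an arbitrary element of) the set $\{s\in\mathbb C^6:\|s\|^2=r_d[\xi]\}$.
   Context: Let $n,m\ge1$ be integers. Products, absolute values, squares, square roots, exponentials and equalities of $n\times n$ arrays are elementwise; $\mathrm j=\sqrt{-1}$; indices are $\xi=(\xi_1,\xi_2)$, $1\le\xi_1,\xi_2\le n$, and $w[\xi]$ is the entry of $w$ at $\xi$. Let $\mathcal I=\{XX,XY,XZ,YX,YY,YZ\}$ and $\mathcal H=(\mathbb C^{n\times n})^6$, with elements $x=(x_c)_{c\in\mathcal I}$, with Frobenius norm $\|x\|^2=\sum_{c\in\mathcal I}\sum_\xi|x_c[\xi]|^2$; for $x\in\mathcal H$, $x[\xi]=(x_c[\xi])_{c\in\mathcal I}\in\mathbb C^6$. For $\Omega\subset\mathcal H$, $P_\Omega(x)=\{w\in\Omega:\|x-w\|=\inf_{v\in\Omega}\|x-v\|\}$. $\mathcal F$ is the (unitary) two-dimensional discrete Fourier transform on $\mathbb C^{n\times n}$. For $d=1,\dots,m$, $\phi_d\in\mathbb R^{n\times n}$ and $r_d\in\mathbb R_+^{n\times n}$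 (entrywise nonnegative) are given. $M_d:\mathcal H\to\mathcal H$, $M_d(x)=(\mathcal F(x_c\cdot e^{\mathrm j\phi_d}))_{c\in\mathcal I}$, is a unitary transform with inverse $M_d^{-1}(x)=(\mathcal F^{-1}(x_c)\cdot e^{-\mathrm j\phi_d})_{c\in\mathcal I}$. $\mathcal G_d(x)=\sqrt{\sum_{c\in\mathcal I}|M_d(x)_c|^2}\in\mathbb R_+^{n\times n}$. The intensity constraint set is $\Omega_d=\{x\in\mathcal H:\sum_{c\in\mathcal I}|\mathcal F(x_c\cdot e^{\mathrm j\phi_d})|^2=r_d\}$. *)

theory Defs
  imports "HOL-Analysis.Analysis"
begin

datatype channel = XX | XY | XZ | YX | YY | YZ

instance channel :: finite
proof
  have "(UNIV :: channel set) = {XX, XY, XZ, YX, YY, YZ}"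
    using channel.exhaust by auto
  then show "finite (UNIV :: channel set)"
    by (metis finite.emptyI finite_insert)
qed

text \<open>
  The size \<open>n\<close> of the arrays is \<open>CARD('n)\<close>, for an arbitrary nonempty finite linearly ordered
  index type \<open>'n\<close>; the order only serves to identify \<open>'n\<close> with \<open>{1..n}\<close>. The entry of an array
  \<open>w\<close> at \<open>(i, j)\<close> is \<open>w $ i $ j\<close>. On \<open>'n fields\<close>, on \<open>complex ^ channel\<close> and on arrays, the
  library norm is the Frobenius (Euclidean) norm.
\<close>

type_synonym ('a, 'n) array = "'a ^ 'n ^ 'n"
type_synonym 'n fields = "complex ^ 'n ^ 'n ^ channel"

text \<open>Zero-based position, that is \<open>\<xi> - 1\<close> for the index \<open>\<xi>\<close> in \<open>{1..n}\<close>.\<close>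

definition pos :: "'n::{finite,linorder} \<Rightarrow> nat" where
  "pos i = card {k. k < i}"

text \<open>
  The factor \<open>1 / n\<close> makes the two-dimensional transform unitary; the frequency and space origins
  are at the first index in each direction.
\<close>

definition dft2 :: "(complex, 'n::{finite,linorder}) array \<Rightarrow> (complex, 'n) array" where
  "dft2 w = (\<chi> i j. (1 / of_nat CARD('n)) *
     (\<Sum>k\<in>UNIV. \<Sum>l\<in>UNIV. w $ k $ l *
        exp (- (2 * of_real pi * \<i> * of_nat (pos i * pos k + pos j * pos l) / of_nat CARD('n)))))"

definition modulate :: "(real, 'n) array \<Rightarrow> (complex, 'n::finite) array \<Rightarrow> (complex, 'n) array" where
  "modulate \<phi> w = (\<chi> i j. w $ i $ j * exp (\<i> * of_real (\<phi> $ i $ j)))"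

definition meas :: "(real, 'n) array \<Rightarrow> 'n::{finite,linorder} fields \<Rightarrow> 'n fields" where
  "meas \<phi> x = (\<chi> c. dft2 (modulate \<phi> (x $ c)))"

definition meas_inv :: "(real, 'n) array \<Rightarrow> 'n::{finite,linorder} fields \<Rightarrow> 'n fields" where
  "meas_inv \<phi> x = (\<chi> c. modulate (- \<phi>) (inv dft2 (x $ c)))"

definition at_index :: "'n::finite fields \<Rightarrow> 'n \<Rightarrow> 'n \<Rightarrow> complex ^ channel" where
  "at_index x i j = (\<chi> c. x $ c $ i $ j)"

definition magnitude :: "(real, 'n) array \<Rightarrow> 'n::{finite,linorder} fields \<Rightarrow> (real, 'n) array" where
  "magnitude \<phi> x = (\<chi> i j. sqrt (\<Sum>c\<in>UNIV. (cmod (meas \<phi> x $ c $ i $ j))\<^sup>2))"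

definition intensity_set ::
  "(real, 'n) array \<Rightarrow> (real, 'n) array \<Rightarrow> 'n::{finite,linorder} fields set" where
  "intensity_set \<phi> r =
     {x. (\<chi> i j. \<Sum>c\<in>UNIV. (cmod (dft2 (modulate \<phi> (x $ c)) $ i $ j))\<^sup>2) = r}"

definition proj :: "'a::real_normed_vector set \<Rightarrow> 'a \<Rightarrow> 'a set" where
  "proj S x = {w \<in> S. norm (x - w) = (INF v\<in>S. norm (x - v))}"

end

theory Submission
  imports Defs
begin

text \<open>
  The measurement \<^term>\<open>meas \<phi>\<close> is a linear isometry of the space of fields onto itself, and the
  intensity set is the preimage under it of a product of spheres: one sphere in
  \<^typ>\<open>complex ^ channel\<close> for each index, centred at the origin. A surjective isometry carries
  nearest points to nearest points (\<open>proj_vimage_isometry\<close>), so it suffices to project onto that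
  product. The squared Frobenius distance is a sum over the indices of squared distances in
  \<^typ>\<open>complex ^ channel\<close>, and each summand is bounded below by the square of the distance to
  the sphere there. All these bounds are attained at once, so the nearest points of the product are
  exactly the fields that are nearest at each index (\<open>proj_product_of_spheres\<close>). Finally, the
  nearest point of a sphere is the radial rescaling, except that for the centre every point of
  the sphere is nearest (\<open>dist_to_sphere_attained_iff\<close>).

  That \<^const>\<open>dft2\<close> is an isometry follows from the one-dimensional Parseval identity, used once
  in each direction; surjectivity then holds because an injective linear map of a
  finite-dimensional space into itself is onto.
\<close>

section \<open>The discrete Fourier transform is unitary\<close>

lemma bij_betw_pos: "bij_betw (pos :: 'n::{finite,linorder} \<Rightarrow> nat) UNIV {..<CARD('n)}"
proof -
  have mono: "pos i < pos j" if "i < j" for i j :: 'n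
    unfolding pos_def using that by (intro psubset_card_mono) (auto simp: psubset_eq)
  have inj: "inj (pos :: 'n \<Rightarrow> nat)"
    by (rule injI) (metis mono less_irrefl linorder_neqE)
  have "range (pos :: 'n \<Rightarrow> nat) \<subseteq> {..<CARD('n)}"
    unfolding pos_def by (auto intro!: psubset_card_mono)
  moreover have "card (range (pos :: 'n \<Rightarrow> nat)) = card {..<CARD('n)}"
    using inj by (simp add: card_image)
  ultimately have "range (pos :: 'n \<Rightarrow> nat) = {..<CARD('n)}"
    by (intro card_subset_eq) auto
  with inj show ?thesis by (simp add: bij_betw_def)
qed

definition dft_kernel :: "'n::{finite,linorder} \<Rightarrow> 'n \<Rightarrow> complex" where
  "dft_kernel i k = exp (- (2 * of_real pi * \<i> * of_nat (pos i * pos k) / of_nat CARD('n)))"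

text \<open>
  Each summand is a power \<open>z ^ pos i\<close> of one \<open>n\<close>-th root of unity \<open>z\<close>, which equals
  1 only if the columns agree; the sum is therefore a geometric sum over a full period.
\<close>

lemma dft_kernel_orthogonal:
  fixes k l :: "'n::{finite,linorder}"
  shows "(\<Sum>i\<in>UNIV. dft_kernel i k * cnj (dft_kernel i l)) = (if k = l then of_nat CARD('n) else 0)"
proof -
  define n where "n = CARD('n)"
  have n: "n > 0" by (simp add: n_def)
  define e where "e p = exp (2 * of_real pi * \<i> * of_nat p / of_nat n)" for p :: nat
  define z where "z = e (pos l) / e (pos k)"
  have pos_less: "pos i < n" for i :: 'n
    using bij_betw_pos[where 'n='n] by (auto simp: bij_betw_def n_def)
  have e_mult: "e (p * q) = e q ^ p" for p q
    unfolding e_def exp_of_nat_mult[symmetric] by (simp add: field_simps)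
  have kernel: "dft_kernel i j = inverse (e (pos i * pos j))" for i j :: 'n
    by (simp add: dft_kernel_def e_def n_def exp_minus)
  have cnj_e: "cnj (inverse (e p)) = e p" for p
    by (simp add: e_def exp_cnj exp_minus[symmetric])
  have "dft_kernel i k * cnj (dft_kernel i l) = z ^ pos i" for i :: 'n
    unfolding kernel cnj_e unfolding z_def e_mult by (simp add: power_divide field_simps)
  then have "(\<Sum>i\<in>UNIV. dft_kernel i k * cnj (dft_kernel i l)) = (\<Sum>i\<in>(UNIV::'n set). z ^ pos i)"
    by simp
  also have "\<dots> = (\<Sum>p<n. z ^ p)"
    unfolding n_def using bij_betw_pos[where 'n='n] by (rule sum.reindex_bij_betw)
  finally have sum: "(\<Sum>i\<in>UNIV. dft_kernel i k * cnj (dft_kernel i l)) = (\<Sum>p<n. z ^ p)" .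
  have e_nz: "e p \<noteq> 0" for p by (simp add: e_def)
  show ?thesis
  proof (cases "k = l")
    case True
    then have "z = 1" by (simp add: z_def e_nz)
    with True sum show ?thesis by (simp add: n_def)
  next
    case False
    have "e p ^ n = 1" for p
      using n by (simp add: e_def complex_root_unity)
    then have zn: "z ^ n = 1" by (simp add: z_def power_divide)
    have "pos k \<noteq> pos l"
      using False bij_betw_pos[where 'n='n] by (auto simp: bij_betw_def inj_on_def)
    then have "e (pos l) \<noteq> e (pos k)"
      unfolding e_def using complex_root_unity_eq[of n "pos l" "pos k"] n pos_less[of k] pos_less[of l]
      by simp
    then have "z \<noteq> 1" by (simp add: z_def e_nz)
    with False sum zn show ?thesis by (simp add: sum_gp_strict)
  qed
qed

text \<open>
  Expanding the squared moduli into double sums and summing over \<open>i\<close> first, orthogonality of the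
  columns leaves only the diagonal terms.
\<close>

lemma parseval_dft_kernel:
  fixes a :: "'n::{finite,linorder} \<Rightarrow> complex"
  shows "(\<Sum>i\<in>UNIV. (cmod (\<Sum>k\<in>UNIV. a k * dft_kernel i k))\<^sup>2)
       = real CARD('n) * (\<Sum>k\<in>UNIV. (cmod (a k))\<^sup>2)"
proof -
  have "complex_of_real (\<Sum>i\<in>UNIV. (cmod (\<Sum>k\<in>UNIV. a k * dft_kernel i k))\<^sup>2)
      = (\<Sum>i\<in>UNIV. \<Sum>k\<in>UNIV. \<Sum>l\<in>UNIV. a k * cnj (a l) * (dft_kernel i k * cnj (dft_kernel i l)))"
    unfolding of_real_sum complex_norm_square cnj_sum sum_product
    by (simp add: mult_ac)
  also have "\<dots> = (\<Sum>k\<in>UNIV. \<Sum>l\<in>UNIV. \<Sum>i\<in>UNIV. a k * cnj (a l) * (dft_kernel i k * cnj (dft_kernel i l)))"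
    by (subst sum.swap) (intro sum.cong refl sum.swap)
  also have "\<dots> = (\<Sum>k\<in>UNIV. \<Sum>l\<in>UNIV. a k * cnj (a l) * (if k = l then of_nat CARD('n) else 0))"
    by (simp only: sum_distrib_left[symmetric] dft_kernel_orthogonal)
  also have "\<dots> = (\<Sum>k\<in>UNIV. a k * cnj (a k) * of_nat CARD('n))"
    by (simp add: if_distrib[of "(*) _"] cong: if_cong)
  also have "\<dots> = complex_of_real (real CARD('n) * (\<Sum>k\<in>UNIV. (cmod (a k))\<^sup>2))"
    by (simp only: of_real_mult of_real_sum complex_norm_square sum_distrib_left of_real_of_nat_eq mult.commute)
  finally show ?thesis by (simp only: of_real_eq_iff)
qed

lemma norm_vec_squared: "(norm v)\<^sup>2 = (\<Sum>i\<in>UNIV. (norm (v $ i))\<^sup>2)"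
  by (simp add: norm_vec_def L2_set_def sum_nonneg)

text \<open>The kernel of the two-dimensional transform is a product, so that one direction is
  transformed after the other.\<close>

lemma dft2_nth:
  fixes w :: "(complex, 'n::{finite,linorder}) array"
  shows "dft2 w $ i $ j
    = (1 / of_nat CARD('n)) * (\<Sum>k\<in>UNIV. (\<Sum>l\<in>UNIV. w $ k $ l * dft_kernel j l) * dft_kernel i k)"
proof -
  have "exp (- (2 * of_real pi * \<i> * of_nat (pos i * pos k + pos j * pos l) / of_nat CARD('n)))
      = dft_kernel i k * dft_kernel j l" for k l :: 'n
    unfolding dft_kernel_def exp_add[symmetric] by (simp add: distrib_left add_divide_distrib)
  then show ?thesis
    by (simp add: dft2_def sum_distrib_left sum_divide_distrib mult_ac)
qed

lemma linear_dft2: "linear (dft2 :: (complex, 'n::{finite,linorder}) array \<Rightarrow> _)"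
proof (rule linearI)
  fix v w :: "(complex, 'n) array" and a :: real
  show "dft2 (v + w) = dft2 v + dft2 w"
    by (simp add: vec_eq_iff dft2_nth distrib_right sum.distrib add_divide_distrib)
  show "dft2 (a *\<^sub>R w) = a *\<^sub>R dft2 w"
    by (simp add: vec_eq_iff dft2_nth mult_scaleR_left flip: scaleR_sum_right)
qed

lemma norm_dft2 [simp]:
  fixes w :: "(complex, 'n::{finite,linorder}) array"
  shows "norm (dft2 w) = norm w"
proof -
  define n where "n = real CARD('n)"
  have n: "n > 0" by (simp add: n_def)
  define b where "b j k = (\<Sum>l\<in>UNIV. w $ k $ l * dft_kernel j l)" for j k
  have "(norm (dft2 w))\<^sup>2 = (\<Sum>i\<in>UNIV. \<Sum>j\<in>UNIV. (1 / n)\<^sup>2 * (cmod (\<Sum>k\<in>UNIV. b j k * dft_kernel i k))\<^sup>2)"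
    by (simp add: norm_vec_squared dft2_nth norm_mult norm_divide power_mult_distrib b_def n_def
        power_divide)
  also have "\<dots> = (1 / n)\<^sup>2 * (\<Sum>j\<in>UNIV. \<Sum>i\<in>UNIV. (cmod (\<Sum>k\<in>UNIV. b j k * dft_kernel i k))\<^sup>2)"
    by (subst sum.swap) (simp only: sum_distrib_left)
  also have "\<dots> = (1 / n)\<^sup>2 * (n * (\<Sum>k\<in>UNIV. \<Sum>j\<in>UNIV. (cmod (b j k))\<^sup>2))"
    unfolding parseval_dft_kernel n_def sum_distrib_left[symmetric]
    by (subst sum.swap) simp
  also have "\<dots> = (1 / n)\<^sup>2 * (n * (n * (\<Sum>k\<in>UNIV. \<Sum>l\<in>UNIV. (cmod (w $ k $ l))\<^sup>2)))"
    unfolding b_def parseval_dft_kernel n_def sum_distrib_left[symmetric] ..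
  also have "\<dots> = (norm w)\<^sup>2"
    using n unfolding norm_vec_squared by (simp add: power2_eq_square)
  finally show ?thesis by simp
qed

lemma bij_dft2: "bij (dft2 :: (complex, 'n::{finite,linorder}) array \<Rightarrow> _)"
proof -
  have "inj (dft2 :: (complex, 'n) array \<Rightarrow> _)"
    unfolding linear_injective_0[OF linear_dft2] by (metis norm_dft2 norm_eq_zero)
  then show ?thesis
    using linear_injective_imp_surjective[OF linear_dft2] by (simp add: bij_def)
qed

section \<open>The measurement is a linear isometry onto\<close>

lemma modulate_modulate_minus:
  "modulate \<phi> (modulate (- \<phi>) w) = w" "modulate (- \<phi>) (modulate \<phi> w) = w"
  by (simp_all add: vec_eq_iff modulate_def mult.assoc flip: exp_add)

lemma norm_modulate [simp]: "norm (modulate \<phi> w) = norm w"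
  by (simp add: norm_vec_def modulate_def norm_mult)

lemma modulate_diff: "modulate \<phi> (v - w) = modulate \<phi> v - modulate \<phi> w"
  by (simp add: vec_eq_iff modulate_def left_diff_distrib)

lemma meas_meas_inv: "meas \<phi> (meas_inv \<phi> y) = y"
  by (simp add: vec_eq_iff meas_def meas_inv_def modulate_modulate_minus
      surj_f_inv_f[OF bij_is_surj[OF bij_dft2]])

lemma meas_inv_meas: "meas_inv \<phi> (meas \<phi> x) = x"
  by (simp add: vec_eq_iff meas_def meas_inv_def modulate_modulate_minus
      inv_f_f[OF bij_is_inj[OF bij_dft2]])

lemma meas_diff: "meas \<phi> (x - y) = meas \<phi> x - meas \<phi> y"
  by (simp add: vec_eq_iff meas_def modulate_diff linear_diff[OF linear_dft2])

lemma norm_meas [simp]: "norm (meas \<phi> x) = norm x"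
  unfolding norm_vec_def[of "meas \<phi> x"] norm_vec_def[of x] by (simp add: meas_def)

section \<open>Nearest points\<close>

lemma proj_vimage_isometry:
  fixes f :: "'a::real_normed_vector \<Rightarrow> 'b::real_normed_vector"
  assumes diff: "\<And>x y. f (x - y) = f x - f y" and norm: "\<And>x. norm (f x) = norm x" and "surj f"
  shows "proj (f -` S) x = f -` proj S (f x)"
proof -
  have "norm (x - v) = norm (f x - f v)" for v
    by (metis diff norm)
  moreover have "f ` (f -` S) = S"
    using \<open>surj f\<close> by (simp add: surj_image_vimage_eq)
  then have "(INF v\<in>f -` S. norm (f x - f v)) = (INF v\<in>S. norm (f x - v))"
    by (metis (no_types, lifting) image_cong image_image)
  ultimately show ?thesis
    by (auto simp: proj_def)
qed

lemma proj_eq_attained_lower_bound: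
  assumes "v \<in> S" "norm (x - v) = b" and "\<And>w. w \<in> S \<Longrightarrow> b \<le> norm (x - w)"
  shows "proj S x = {w \<in> S. norm (x - w) = b}"
proof -
  have "(INF w\<in>S. norm (x - w)) = b"
    using assms by (intro cInf_eq_minimum) auto
  then show ?thesis by (simp add: proj_def)
qed

text \<open>
  Expanding the squares, the distance from \<open>u\<close> to a point \<open>s\<close> of the sphere takes its least value
  exactly in the equality case of the Cauchy--Schwarz inequality for \<open>u\<close> and \<open>s\<close>.
\<close>

lemma dist_to_sphere_attained_iff:
  fixes u s :: "'a::real_inner"
  assumes "\<rho> \<ge> 0"
  shows "norm s = \<rho> \<and> norm (u - s) = \<bar>norm u - \<rho>\<bar> \<longleftrightarrow>
    (if u = 0 then norm s = \<rho> else s = (\<rho> / norm u) *\<^sub>R u)"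
proof (cases "u = 0")
  case True
  then show ?thesis using assms by auto
next
  case False
  have "norm (u - s) = \<bar>norm u - \<rho>\<bar> \<longleftrightarrow> s = (\<rho> / norm u) *\<^sub>R u" if s: "norm s = \<rho>"
  proof -
    have "norm (u - s) = \<bar>norm u - \<rho>\<bar> \<longleftrightarrow> (norm (u - s))\<^sup>2 = (norm u - \<rho>)\<^sup>2"
      by (metis abs_ge_zero norm_ge_zero power2_abs power2_eq_iff_nonneg)
    also have "\<dots> \<longleftrightarrow> u \<bullet> s = norm u * norm s"
      unfolding dot_norm_neg power2_diff s by argo
    also have "\<dots> \<longleftrightarrow> norm u *\<^sub>R s = \<rho> *\<^sub>R u"
      using norm_cauchy_schwarz_eq[of u s] unfolding s .
    also have "\<dots> \<longleftrightarrow> s = (\<rho> / norm u) *\<^sub>R u"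
      using False by (simp add: eq_vector_fraction_iff)
    finally show ?thesis .
  qed
  moreover have "norm ((\<rho> / norm u) *\<^sub>R u) = \<rho>"
    using False assms by simp
  ultimately show ?thesis using False by auto
qed

lemma norm_squared_eq_sum_at_index:
  "(norm x)\<^sup>2 = (\<Sum>i\<in>UNIV. \<Sum>j\<in>UNIV. (norm (at_index x i j))\<^sup>2)"
proof -
  have "(norm x)\<^sup>2 = (\<Sum>c\<in>UNIV. \<Sum>i\<in>UNIV. \<Sum>j\<in>UNIV. (cmod (x $ c $ i $ j))\<^sup>2)"
    by (simp add: norm_vec_squared)
  also have "\<dots> = (\<Sum>i\<in>UNIV. \<Sum>j\<in>UNIV. \<Sum>c\<in>UNIV. (cmod (x $ c $ i $ j))\<^sup>2)"
    by (subst sum.swap) (intro sum.cong refl sum.swap)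
  finally show ?thesis
    by (simp add: norm_vec_squared at_index_def)
qed

lemma at_index_diff: "at_index (x - y) i j = at_index x i j - at_index y i j"
  by (simp add: at_index_def vec_eq_iff)

definition product_of_spheres :: "(real, 'n) array \<Rightarrow> 'n::finite fields set" where
  "product_of_spheres \<rho> = {y. \<forall>i j. norm (at_index y i j) = \<rho> $ i $ j}"

definition nearest_at_each_index :: "(real, 'n) array \<Rightarrow> 'n::finite fields \<Rightarrow> 'n fields set" where
  "nearest_at_each_index \<rho> u = {y. \<forall>i j.
     if at_index u i j = 0 then norm (at_index y i j) = \<rho> $ i $ j
     else at_index y i j = (\<rho> $ i $ j / norm (at_index u i j)) *\<^sub>R at_index u i j}"

text \<open>
  The squared distance and its lower bound are sums over the same indices, ordered term by term.
  Hence the sums agree only if all terms agree, which is nearness at each index.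
\<close>

lemma proj_product_of_spheres:
  fixes u :: "'n::finite fields"
  assumes \<rho>: "\<And>i j. \<rho> $ i $ j \<ge> 0"
  shows "proj (product_of_spheres \<rho>) u = nearest_at_each_index \<rho> u"
proof -
  define g where "g i j = \<bar>norm (at_index u i j) - \<rho> $ i $ j\<bar>" for i j
  define b where "b = sqrt (\<Sum>i\<in>UNIV. \<Sum>j\<in>UNIV. (g i j)\<^sup>2)"
  have g0: "0 \<le> g i j" for i j by (simp add: g_def)
  have b0: "0 \<le> b" and b2: "b\<^sup>2 = (\<Sum>i\<in>UNIV. \<Sum>j\<in>UNIV. (g i j)\<^sup>2)"
    unfolding b_def by (simp_all add: sum_nonneg)
  have dist: "(norm (u - y))\<^sup>2 = (\<Sum>i\<in>UNIV. \<Sum>j\<in>UNIV. (norm (at_index u i j - at_index y i j))\<^sup>2)" for y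
    by (simp add: norm_squared_eq_sum_at_index at_index_diff)
  have g_le: "(g i j)\<^sup>2 \<le> (norm (at_index u i j - at_index y i j))\<^sup>2"
    if "y \<in> product_of_spheres \<rho>" for y i j
    using that norm_triangle_ineq3[of "at_index u i j" "at_index y i j"]
    by (intro power_mono[OF _ g0]) (simp add: product_of_spheres_def g_def)
  have nearest_iff: "y \<in> nearest_at_each_index \<rho> u \<longleftrightarrow> y \<in> product_of_spheres \<rho> \<and>
      (\<forall>i j. norm (at_index u i j - at_index y i j) = g i j)" for y
    unfolding nearest_at_each_index_def product_of_spheres_def g_def mem_Collect_eq
      dist_to_sphere_attained_iff[OF \<rho>, symmetric] by blast
  have lower: "b \<le> norm (u - y)" if "y \<in> product_of_spheres \<rho>" for y
  proof -
    have "b\<^sup>2 \<le> (norm (u - y))\<^sup>2"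
      unfolding b2 dist by (intro sum_mono g_le that)
    then show ?thesis by (rule power2_le_imp_le) simp
  qed
  have attained: "norm (u - y) = b \<longleftrightarrow> y \<in> nearest_at_each_index \<rho> u"
    if y: "y \<in> product_of_spheres \<rho>" for y
  proof -
    have "norm (u - y) = b \<longleftrightarrow> (norm (u - y))\<^sup>2 = b\<^sup>2"
      using b0 by (simp add: power2_eq_iff_nonneg)
    also have "\<dots> \<longleftrightarrow>
        (\<Sum>i\<in>UNIV. \<Sum>j\<in>UNIV. (norm (at_index u i j - at_index y i j))\<^sup>2 - (g i j)\<^sup>2) = 0"
      by (simp add: b2 dist sum_subtractf)
    also have "\<dots> \<longleftrightarrow> (\<forall>i j. (norm (at_index u i j - at_index y i j))\<^sup>2 - (g i j)\<^sup>2 = 0)"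
      using g_le[OF y] by (simp add: sum_nonneg_eq_0_iff sum_nonneg)
    also have "\<dots> \<longleftrightarrow> (\<forall>i j. norm (at_index u i j - at_index y i j) = g i j)"
      using g0 by (simp add: power2_eq_iff_nonneg)
    finally show ?thesis using y by (simp add: nearest_iff)
  qed
  \<comment> \<open>At an index where \<open>u\<close> vanishes, any vector of the right length will do.\<close>
  have "\<exists>s. if at_index u i j = 0 then norm s = \<rho> $ i $ j
      else s = (\<rho> $ i $ j / norm (at_index u i j)) *\<^sub>R at_index u i j" for i j
    using vector_choose_size[OF \<rho>[of i j]] by auto
  then obtain s where s: "\<And>i j. if at_index u i j = 0 then norm (s i j) = \<rho> $ i $ j
      else s i j = (\<rho> $ i $ j / norm (at_index u i j)) *\<^sub>R at_index u i j"
    by metis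
  define y where "y = (\<chi> c i j. s i j $ c)"
  have "at_index y i j = s i j" for i j
    by (simp add: y_def at_index_def vec_eq_iff)
  with s have y: "y \<in> nearest_at_each_index \<rho> u"
    by (simp add: nearest_at_each_index_def)
  then have "y \<in> product_of_spheres \<rho>" by (simp add: nearest_iff)
  moreover from this y have "norm (u - y) = b" by (simp add: attained)
  ultimately have "proj (product_of_spheres \<rho>) u = {y \<in> product_of_spheres \<rho>. norm (u - y) = b}"
    using lower by (rule proj_eq_attained_lower_bound)
  then show ?thesis using attained nearest_iff by blast
qed

section \<open>Projection onto the intensity set\<close>

lemma magnitude_nth: "magnitude \<phi> x $ i $ j = norm (at_index (meas \<phi> x) i j)"
  by (simp add: magnitude_def at_index_def norm_vec_def L2_set_def)

lemma norm_squared_eq_iff: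
  assumes "0 \<le> t"
  shows "(norm s)\<^sup>2 = t \<longleftrightarrow> norm s = sqrt t"
  using assms by (metis norm_ge_zero real_sqrt_pow2 real_sqrt_unique)

lemma intensity_set_eq_vimage:
  assumes "\<And>i j. 0 \<le> r $ i $ j"
  shows "intensity_set \<phi> r = meas \<phi> -` product_of_spheres (\<chi> i j. sqrt (r $ i $ j))"
proof -
  have "(\<Sum>c\<in>UNIV. (cmod (dft2 (modulate \<phi> (x $ c)) $ i $ j))\<^sup>2) = (norm (at_index (meas \<phi> x) i j))\<^sup>2"
    for x i j
    by (simp add: norm_vec_squared at_index_def meas_def)
  then show ?thesis
    by (auto simp: intensity_set_def product_of_spheres_def vec_eq_iff norm_squared_eq_iff assms)
qed

theorem lemma3p6:
  fixes m d :: nat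
    and \<phi> r :: "nat \<Rightarrow> (real, 'n::{finite,linorder}) array"
    and x :: "'n fields"
  assumes "m \<ge> 1"
    and "\<And>d i j. d \<in> {1..m} \<Longrightarrow> 0 \<le> r d $ i $ j"
    and "d \<in> {1..m}"
  shows "proj (intensity_set (\<phi> d) (r d)) x =
    {meas_inv (\<phi> d) y | y.
       \<forall>i j.
         (magnitude (\<phi> d) x $ i $ j \<noteq> 0 \<longrightarrow>
            at_index y i j =
              (sqrt (r d $ i $ j) / magnitude (\<phi> d) x $ i $ j) *\<^sub>R at_index (meas (\<phi> d) x) i j) \<and>
         (magnitude (\<phi> d) x $ i $ j = 0 \<longrightarrow>
            at_index y i j \<in> {s :: complex ^ channel. (norm s)\<^sup>2 = r d $ i $ j})}"
    (is "_ = {meas_inv _ y | y. ?Q y}")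
proof -
  define \<rho> :: "(real, 'n) array" where "\<rho> = (\<chi> i j. sqrt (r d $ i $ j))"
  have r: "0 \<le> r d $ i $ j" for i j using assms by blast
  have \<rho>: "0 \<le> \<rho> $ i $ j" for i j using r by (simp add: \<rho>_def)
  have "surj (meas (\<phi> d))"
    using meas_meas_inv by (rule surjI)
  then have "proj (intensity_set (\<phi> d) (r d)) x
      = meas (\<phi> d) -` nearest_at_each_index \<rho> (meas (\<phi> d) x)"
    unfolding intensity_set_eq_vimage[OF r] \<rho>_def[symmetric] proj_product_of_spheres[OF \<rho>, symmetric]
    by (intro proj_vimage_isometry meas_diff norm_meas)
  also have "\<dots> = {meas_inv (\<phi> d) y | y. y \<in> nearest_at_each_index \<rho> (meas (\<phi> d) x)}"
    by (force simp: meas_meas_inv intro: meas_inv_meas[symmetric])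
  also have "nearest_at_each_index \<rho> (meas (\<phi> d) x) = Collect ?Q"
    by (auto simp: nearest_at_each_index_def magnitude_nth \<rho>_def norm_squared_eq_iff r)
  finally show ?thesis by simp
qed

end
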